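(* Let the difference equation, the numbers $\rho_i,e_i,k_i$, the integer $m$, the solution space $V_m$ and the subspaces $V_{m,i}^\vee$, $V_{m,i}^\wedge$ ($1\le i\le s+1$) be as described in the context, and put $V_{m,j}^\ast=V_{m,1}^\vee\oplus\cdots\oplus V_{m,j}^\vee$ for $j=1,\ldots,s+1$. Let $\theta\in\{1,\ldots,s\}$, let $\xi_\theta:V_{m,\theta}^\ast\to V_{m,\theta+1}^\wedge$ be a linear map, let $I_\theta^\ast$ be the identity map $V_{m,\theta}^\ast\to V_{m,\theta}^\ast$, and let $$V=(I_\theta^\ast+\xi_\theta)(V_{m,\theta}^\ast)=\{y+\xi_\theta(y):y\in V_{m,\theta}^\ast\}\subset V_m.$$ Put $k=\max(k_1,\ldots,k_s)$. Then there exists a constant $A^\ast=A^\ast(V)>0$ such that $$\exp\bigl(-A^\ast(\ln(\nu)+\nu^{1-1/k})\bigr)\,(\rho_\theta)^{\nu}\,\omega_{n,y}(m)\le\omega_{n,y}(\nu)$$ for all $y\in V$ and all integers $\nu\ge m$.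
   Context: Notation: $\mathbb N=\{1,2,3,\ldots\}$. Setting: let $s\ge 0$ be an integer, $n\in\mathbb N$, $a_i^\sim\in\mathbb C$ and $a_i(\nu)\in\mathbb C$ for $i=0,\ldots,n$ and integers $\nu\ge 0$, with $a_n(\nu)=1$ for all $\nu\ge0$ and $a_i(\nu)-a_i^\sim=O(1/(\nu+1))$ for $i=0,\ldots,n$ (so $a_n^\sim=1$). For $m\in\mathbb N$, $V_m$ denotes the $\mathbb C$-linear space of solutions $y=(y(\nu))_{\nu\ge m}$, $y(\nu)\in\mathbb C$, of $$\sum_{k=0}^n a_k(\nu)y(\nu+k)=0,\qquad \nu\ge m.$$ Let $T(z)=\sum_{k=0}^n a_k^\sim z^k$ be the characteristic polynomial. The absolute values of all roots of $T$ are assumed to be among the real numbers $\rho_1>\rho_2>\cdots>\rho_s>\rho_{s+1}=0$. For $i=1,\ldots,s+1$, $e_i$ and $k_i$ denote respectively the sum and the maximum of the multiplicities of those roots of $T$ whose absolute value equals $\rho_i$ (both $0$ if there are none); put $k^\ast=k_{s+1}$. It is assumed that $e_i>0$ for $i=1,\ldots,s$. For a sequence $y=(y(\nu))_{\nu\ge m}$ put $$\omega_{n,y}(\nu)=\max(|y(\nu)|,\ldots,|y(\nu+n-1)|).$$ Fix data as provided by the following previously known theorem: there exist $A>0$, $m\in\mathbb N$, numbers $\alpha(\nu)>0$ ($\nu\ge m$) with $\alpha(\nu)\to0$ as $\nu\to\infty$, and subspaces $V_{m,1}^\vee,\ldots,V_{m,s+1}^\vee$ of $V_m$ such that $V_m=V_{m,1}^\vee\oplus\cdots\oplus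 V_{m,s+1}^\vee$, $\dim_{\mathbb C}V_{m,i}^\vee=e_i$, and, with $$V_{m,j}^\wedge=V_{m,j}^\vee\oplus\cdots\oplus V_{m,s+1}^\vee\quad(1\le j\le s+1)$$ and $\pi_j:V_{m,j}^\wedge\to V_{m,j}^\vee$ ($1\le j\le s$) the natural projection (with kernel $V_{m,j+1}^\wedge$), the following hold for all $\nu\ge m$: (1) if $y\in V_{m,\theta}^\vee$ with $1\le\theta\le s$, then $\exp(-A(\ln\nu+\nu^{1-1/k_\theta}))\rho_\theta^\nu\,\omega_{n,y}(m)\le\omega_{n,y}(\nu)$; (2) if $y\in V_{m,\theta}^\wedge$ with $1\le\theta\le s$, then $\omega_{n,y}(\nu)\le\exp(A(\ln\nu+\nu^{1-1/k_\theta}))\rho_\theta^\nu\,\omega_{n,y}(m)$ and $(\omega_{n,\pi_\theta(y)}(m)-\alpha(\nu)\omega_{n,y}(m))\rho_\theta^\nu\exp(-A(\ln\nu+\nu^{1-1/k_\theta}))\le\omega_{n,y}(\nu)$; (3) if $k^\ast>0$ and $y\in V_{m,s+1}^\vee=V_{m,s+1}^\wedge$, then $|y(\nu)|\le(A/\nu)^{\nu/k^\ast}\omega_{n,y}(m)$. The spaces $V_{m,j}^\wedge$ do not depend on the choice of such a decomposition: $V_{m,j}^\wedge=\{y\in V_m:\limsup_{\nu\to\infty}|y(\nu)|^{1/\nu}\le\rho_j\}$. *)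

theory Defs
  imports "HOL-Analysis.Analysis" "HOL-Library.Function_Algebras"
    "HOL-Library.Landau_Symbols" "HOL-Computational_Algebra.Polynomial"
begin

definition cscale :: "complex \<Rightarrow> (nat \<Rightarrow> complex) \<Rightarrow> nat \<Rightarrow> complex" where
  "cscale c y = (\<lambda>\<nu>. c * y \<nu>)"

global_interpretation cseq: vector_space cscale
  by unfold_locales (simp_all add: cscale_def fun_eq_iff algebra_simps)

text \<open>
  A sequence \<open>(y(\<nu>))\<close> indexed by \<open>\<nu> \<ge> m\<close> is represented by the function on all natural
  numbers that extends it by \<open>0\<close> below \<open>m\<close>.  This makes the representation unique, so that
  dimensions and direct sums of solution spaces come out right.
\<close>

definition sol_space :: "nat \<Rightarrow> (nat \<Rightarrow> nat \<Rightarrow> complex) \<Rightarrow> nat \<Rightarrow> (nat \<Rightarrow> complex) set" where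
  "sol_space n a m =
     {y. (\<forall>\<nu><m. y \<nu> = 0) \<and> (\<forall>\<nu>\<ge>m. (\<Sum>k=0..n. a k \<nu> * y (\<nu> + k)) = 0)}"

definition characteristic_poly :: "nat \<Rightarrow> (nat \<Rightarrow> complex) \<Rightarrow> complex poly" where
  "characteristic_poly n c = (\<Sum>k=0..n. monom (c k) k)"

definition roots_of_modulus :: "complex poly \<Rightarrow> real \<Rightarrow> complex set" where
  "roots_of_modulus T r = {z. poly T z = 0 \<and> cmod z = r}"

definition mult_sum :: "complex poly \<Rightarrow> real \<Rightarrow> nat" where
  "mult_sum T r = (\<Sum>z\<in>roots_of_modulus T r. order z T)"

text \<open>The inserted \<open>0\<close> only matters when there is no root of modulus \<open>r\<close>.\<close>

definition mult_max :: "complex poly \<Rightarrow> real \<Rightarrow> nat" where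
  "mult_max T r = Max (insert 0 ((\<lambda>z. order z T) ` roots_of_modulus T r))"

definition omega :: "nat \<Rightarrow> (nat \<Rightarrow> complex) \<Rightarrow> nat \<Rightarrow> real" where
  "omega n y \<nu> = Max ((\<lambda>i. cmod (y i)) ` {\<nu>..<\<nu> + n})"

definition growth :: "nat \<Rightarrow> nat \<Rightarrow> real" where
  "growth k \<nu> = ln (real \<nu>) + real \<nu> powr (1 - 1 / real k)"

definition subspace_sum ::
  "nat set \<Rightarrow> (nat \<Rightarrow> (nat \<Rightarrow> complex) set) \<Rightarrow> (nat \<Rightarrow> complex) set" where
  "subspace_sum I W = {\<Sum>i\<in>I. w i | w. \<forall>i\<in>I. w i \<in> W i}"

definition is_direct_sum ::
  "nat set \<Rightarrow> (nat \<Rightarrow> (nat \<Rightarrow> complex) set) \<Rightarrow> (nat \<Rightarrow> complex) set \<Rightarrow> bool" where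
  "is_direct_sum I W U \<longleftrightarrow>
     (\<forall>i\<in>I. cseq.subspace (W i)) \<and> U = subspace_sum I W \<and>
     (\<forall>w. (\<forall>i\<in>I. w i \<in> W i) \<and> (\<Sum>i\<in>I. w i) = 0 \<longrightarrow> (\<forall>i\<in>I. w i = 0))"

definition Vwedge ::
  "nat \<Rightarrow> (nat \<Rightarrow> (nat \<Rightarrow> complex) set) \<Rightarrow> nat \<Rightarrow> (nat \<Rightarrow> complex) set" where
  "Vwedge s Vvee j = subspace_sum {j..s+1} Vvee"

definition Vstar ::
  "(nat \<Rightarrow> (nat \<Rightarrow> complex) set) \<Rightarrow> nat \<Rightarrow> (nat \<Rightarrow> complex) set" where
  "Vstar Vvee j = subspace_sum {1..j} Vvee"

text \<open>The projection of \<open>Vwedge s Vvee j\<close> onto \<open>Vvee j\<close> with kernel \<open>Vwedge s Vvee (j + 1)\<close>;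
  it is meaningful for \<open>1 \<le> j \<le> s\<close> when the sum of the spaces \<open>Vvee i\<close> is direct.\<close>

definition vproj ::
  "nat \<Rightarrow> (nat \<Rightarrow> (nat \<Rightarrow> complex) set) \<Rightarrow> nat \<Rightarrow> (nat \<Rightarrow> complex) \<Rightarrow> (nat \<Rightarrow> complex)" where
  "vproj s Vvee j y = (THE v. v \<in> Vvee j \<and> y - v \<in> Vwedge s Vvee (j + 1))"

definition linear_map_between ::
  "(nat \<Rightarrow> complex) set \<Rightarrow> (nat \<Rightarrow> complex) set \<Rightarrow>
   ((nat \<Rightarrow> complex) \<Rightarrow> (nat \<Rightarrow> complex)) \<Rightarrow> bool" where
  "linear_map_between U W f \<longleftrightarrow>
     (\<forall>y\<in>U. f y \<in> W) \<and> (\<forall>x\<in>U. \<forall>y\<in>U. f (x + y) = f x + f y) \<and>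
     (\<forall>c. \<forall>y\<in>U. f (cscale c y) = cscale c (f y))"

end

theory Submission
  imports Defs
begin

text \<open>
  Write \<open>K\<close> for the maximum of the \<open>k i\<close>, and call \<open>exp (B * growth K \<nu>)\<close> a tolerated error.
  By linearity every \<open>y \<in> V\<close> is a sum of \<open>u i = w i + \<xi> (w i)\<close> with \<open>w i \<in> Vvee i\<close> and
  \<open>1 \<le> i \<le> \<theta>\<close>.

  Each \<open>u i\<close> grows exactly like \<open>\<rho> i ^ \<nu>\<close>, up to a tolerated error.  It lies in \<open>Vwedge s Vvee i\<close>,
  which gives the upper bound, and its projection to \<open>Vvee i\<close> is \<open>w i\<close>, because \<open>\<xi>\<close> takes values in
  \<open>Vwedge s Vvee (\<theta> + 1)\<close>.  A solution is determined by its \<open>n\<close> initial values, so \<open>\<xi>\<close> is bounded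
  (\<open>linear_map_omega_bounded\<close>); hence the initial size of \<open>u i\<close> is controlled by that of \<open>w i\<close>, and the
  lower bound with the null sequence \<open>\<alpha>\<close> becomes effective (\<open>rate_between_from_initial\<close>).

  The sum of the \<open>u i\<close> could still suffer cancellation: if \<open>u 1\<close> starts out tiny compared with
  \<open>u 2\<close>, the faster growth of \<open>u 1\<close> makes the two comparable at some late time, which is different
  for every \<open>y\<close>.  Cancellation can only last for a short time, however.  Since the rates \<open>\<rho> i\<close> are
  strictly separated, a component that is not already negligible dominates all slower ones after
  about \<open>growth K \<nu>\<close> further steps; and the recurrence has bounded coefficients, so going back these
  steps from a time at which the sum is known to be large costs a factor exponential in
  \<open>growth K \<nu>\<close>, which is again a tolerated error.  This is \<open>no_cancellation\<close>, and
  \<open>rate_between_sum\<close> iterates it by adding the components one by one, from the slowest to the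
  fastest.  All constants depend on the bounds for the components only, not on \<open>y\<close> or \<open>\<nu>\<close>.
\<close>

section \<open>The growth scale\<close>

text \<open>Because of this bound, constant factors can be absorbed into the tolerated error.\<close>

lemma growth_ge_1:
  assumes "1 \<le> \<nu>"
  shows "1 \<le> growth K \<nu>"
proof -
  have "1 / real K \<le> 1" by (cases "K = 0") auto
  then have "1 \<le> real \<nu> powr (1 - 1 / real K)"
    using assms by (intro ge_one_powr_ge_zero) auto
  with assms show ?thesis by (simp add: growth_def add_increasing)
qed

lemma growth_mono:
  assumes "1 \<le> \<mu>" "\<mu> \<le> \<nu>"
  shows "growth K \<mu> \<le> growth K \<nu>"
proof -
  have "1 / real K \<le> 1" by (cases "K = 0") auto
  then show ?thesis
    using assms unfolding growth_def by (intro add_mono powr_mono2) auto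
qed

lemma growth_mono_multiplicity:
  assumes "1 \<le> \<nu>" "1 \<le> k" "k \<le> K"
  shows "growth k \<nu> \<le> growth K \<nu>"
proof -
  have "1 / real K \<le> 1 / real k"
    using assms by (intro divide_left_mono) auto
  then show ?thesis
    using assms unfolding growth_def by (intro add_mono powr_mono) auto
qed

lemma growth_add_le:
  assumes "1 \<le> \<nu>" "1 \<le> d"
  shows "growth K (\<nu> + d) \<le> 3 * (growth K \<nu> + growth K d)"
proof -
  define M where "M = max \<nu> d"
  define p where "p = 1 - 1 / real K"
  have M: "1 \<le> M" "\<nu> + d \<le> 2 * M" using assms by (auto simp: M_def)
  have p: "0 \<le> p" "p \<le> 1"
    by (cases "K = 0"; simp add: p_def)+
  have "(2::real) powr p \<le> 2 powr 1"
    using p by (intro powr_mono) auto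
  then have two: "(2::real) powr p \<le> 2" by simp
  have "growth K (\<nu> + d) \<le> growth K (2 * M)"
    using assms M by (intro growth_mono) auto
  also have "\<dots> = ln 2 + ln (real M) + 2 powr p * real M powr p"
    using M by (simp add: growth_def p_def ln_mult powr_mult)
  also have "\<dots> \<le> 1 + ln (real M) + 2 * real M powr p"
    using two ln_2_less_1 by (intro add_mono mult_right_mono) auto
  also have "\<dots> \<le> 3 * growth K M"
  proof -
    have "1 \<le> real M powr p" using M p by (intro ge_one_powr_ge_zero) auto
    moreover have "0 \<le> ln (real M)" using M by simp
    ultimately show ?thesis by (simp add: growth_def p_def[symmetric])
  qed
  also have "growth K M \<le> growth K \<nu> + growth K d"
    using growth_ge_1[OF assms(1), of K] growth_ge_1[OF assms(2), of K]
    by (simp add: M_def max_def)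
  finally show ?thesis by simp
qed

lemma growth_sublinear:
  assumes "1 \<le> K" "0 < \<epsilon>"
  shows "eventually (\<lambda>d. growth K d \<le> \<epsilon> * real d) sequentially"
proof -
  have "(\<lambda>x::real. ln x) \<in> o(\<lambda>x. x)"
    by (rule ln_x_over_x_tendsto_0[THEN smalloI_tendsto]) (auto intro: eventually_mono[OF eventually_gt_at_top[of 0]])
  moreover have "(\<lambda>x::real. x powr (1 - 1 / real K)) \<in> o(\<lambda>x. x powr 1)"
    using assms by (subst powr_smallo_iff) (auto simp: filterlim_ident)
  then have "(\<lambda>x::real. x powr (1 - 1 / real K)) \<in> o(\<lambda>x. x)"
    by (rule landau_o.small.ev_eq_trans1) (auto intro: eventually_mono[OF eventually_gt_at_top[of 0]])
  ultimately have "(\<lambda>x::real. ln x + x powr (1 - 1 / real K)) \<in> o(\<lambda>x. x)"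
    by (rule sum_in_smallo)
  then have "eventually (\<lambda>x::real. norm (ln x + x powr (1 - 1 / real K)) \<le> \<epsilon> * norm x) at_top"
    using assms by (intro landau_o.smallD)
  then have "eventually (\<lambda>d. norm (growth K d) \<le> \<epsilon> * norm (real d)) sequentially"
    unfolding growth_def by (rule eventually_compose_filterlim[OF _ filterlim_real_sequentially])
  then show ?thesis by (rule eventually_mono) auto
qed

text \<open>
  Decay at any fixed rate \<open>\<delta>\<close> beats the error at the later time \<open>\<nu> + d\<close> already for some \<open>d\<close> of the order
  of \<open>growth K \<nu>\<close>.  By \<open>growth_add_le\<close> the error at time \<open>\<nu> + d\<close> splits into a multiple of
  \<open>growth K \<nu>\<close>, which \<open>d\<close> is chosen to outweigh, and a part sublinear in \<open>d\<close>.
\<close>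

lemma waiting_time:
  assumes "1 \<le> K" "0 \<le> B" "0 < \<delta>"
  shows "\<exists>D\<ge>0. \<forall>\<nu>\<ge>1. \<exists>d. B * growth K (\<nu> + d) \<le> \<delta> * real d \<and> real d \<le> D * growth K \<nu>"
proof -
  define \<epsilon> where "\<epsilon> = \<delta> / (6 * (B + 1))"
  have "0 < \<epsilon>" using assms by (simp add: \<epsilon>_def)
  from eventually_conj[OF growth_sublinear[OF assms(1) this] eventually_ge_at_top[of 1]]
  obtain N where N: "\<And>d. N \<le> d \<Longrightarrow> growth K d \<le> \<epsilon> * real d \<and> 1 \<le> d"
    by (auto simp: eventually_sequentially)
  define D where "D = real N + 1 + 6 * B / \<delta>"
  show ?thesis
  proof (intro exI[of _ D] conjI allI impI)
    show "0 \<le> D" using assms by (simp add: D_def)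
    fix \<nu> :: nat
    assume \<nu>: "1 \<le> \<nu>"
    define g where "g = growth K \<nu>"
    have g: "1 \<le> g" using growth_ge_1[OF \<nu>] by (simp add: g_def)
    define d where "d = N + nat \<lceil>6 * B / \<delta> * g\<rceil>"
    have nn: "0 \<le> 6 * B / \<delta> * g" using assms g by simp
    have d_ge: "6 * B / \<delta> * g \<le> real d" and d_le: "real d \<le> real N + (6 * B / \<delta> * g + 1)"
      using nn by (simp_all add: d_def) linarith+
    have Nd: "N \<le> d" by (simp add: d_def)
    have "B * growth K (\<nu> + d) \<le> B * (3 * (g + \<epsilon> * real d))"
      using growth_add_le[OF \<nu>, of d K] N[OF Nd] assms
      by (intro mult_left_mono) (auto simp: g_def)
    also have "\<dots> = 3 * B * g + 3 * (B * \<epsilon>) * real d" by (simp add: algebra_simps)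
    also have "\<dots> \<le> \<delta> / 2 * real d + \<delta> / 2 * real d"
    proof (rule add_mono)
      show "3 * B * g \<le> \<delta> / 2 * real d" using d_ge assms by (simp add: field_simps)
      have "B * \<epsilon> \<le> \<delta> / 6" using assms by (simp add: \<epsilon>_def field_simps)
      then show "3 * (B * \<epsilon>) * real d \<le> \<delta> / 2 * real d" by (intro mult_right_mono) auto
    qed
    finally have 1: "B * growth K (\<nu> + d) \<le> \<delta> * real d" by simp
    have "real N + 1 \<le> (real N + 1) * g" using g by (simp add: mult_le_cancel_left1)
    with d_le have 2: "real d \<le> D * g" by (simp add: D_def algebra_simps)
    show "\<exists>d. B * growth K (\<nu> + d) \<le> \<delta> * real d \<and> real d \<le> D * growth K \<nu>"
      using 1 2 by (auto simp: g_def)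
  qed
qed

section \<open>Sums of sequences with separated growth rates\<close>

text \<open>
  The bounds compare any two times and not only the time \<open>\<nu>\<close> with the start \<open>m\<close>.  For a sum of
  components with different rates the comparison with the start would be too weak: the component
  that dominates at time \<open>\<nu>\<close> may be a negligible part of the initial data.
\<close>

definition rate_between :: "nat \<Rightarrow> nat \<Rightarrow> real \<Rightarrow> real \<Rightarrow> real \<Rightarrow> (nat \<Rightarrow> real) \<Rightarrow> bool" where
  "rate_between K m p q B f \<longleftrightarrow>
     (\<forall>\<nu>\<ge>m. \<forall>d. p ^ d * f \<nu> \<le> exp (B * growth K (\<nu> + d)) * f (\<nu> + d) \<and>
                 f (\<nu> + d) \<le> exp (B * growth K (\<nu> + d)) * q ^ d * f \<nu>)"

lemma iterate_step_bound:
  fixes h :: "nat \<Rightarrow> real"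
  assumes "\<And>\<nu>. m \<le> \<nu> \<Longrightarrow> h (Suc \<nu>) \<le> exp L * h \<nu>" "m \<le> \<nu>"
  shows "h (\<nu> + d) \<le> exp (L * real d) * h \<nu>"
proof (induction d)
  case (Suc d)
  have "h (\<nu> + Suc d) \<le> exp L * h (\<nu> + d)" using assms(1)[of "\<nu> + d"] assms(2) by simp
  also have "\<dots> \<le> exp L * (exp (L * real d) * h \<nu>)" by (intro mult_left_mono Suc) auto
  also have "\<dots> = exp (L * real (Suc d)) * h \<nu>" by (simp add: exp_add algebra_simps)
  finally show ?case .
qed simp

text \<open>
  Here \<open>f\<close>, \<open>g\<close>, \<open>h\<close> stand for the sizes of \<open>x\<close>, \<open>z\<close>, \<open>x + z\<close>.  If \<open>f \<nu>\<close> is at most half of \<open>g \<nu>\<close>, the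
  triangle inequality suffices.  Otherwise \<open>g\<close> starts at time \<open>\<nu>\<close> from a value comparable to \<open>f \<nu>\<close>
  at most and grows more slowly, so at the time \<open>\<nu> + d\<close> of \<open>waiting_time\<close> it is at most half of \<open>f\<close>.
  There \<open>h\<close> is at least half of \<open>f\<close>, and the one-step bound on \<open>h\<close> carries this back to time \<open>\<nu>\<close>.
\<close>

lemma no_cancellation:
  assumes "1 \<le> K" "1 \<le> m" "0 \<le> B" "0 \<le> L" "0 < q" "q < r"
  shows "\<exists>C\<ge>0. \<forall>f g h p \<nu>. rate_between K m r r B f \<longrightarrow> rate_between K m p q B g \<longrightarrow>
    (\<forall>\<mu>\<ge>m. 0 \<le> f \<mu> \<and> 0 \<le> g \<mu> \<and> f \<mu> \<le> g \<mu> + h \<mu> \<and> g \<mu> \<le> f \<mu> + h \<mu> \<and> h (Suc \<mu>) \<le> exp L * h \<mu>) \<longrightarrow>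
    m \<le> \<nu> \<longrightarrow> f \<nu> \<le> exp (C * growth K \<nu>) * h \<nu> \<and> g \<nu> \<le> exp (C * growth K \<nu>) * h \<nu>"
proof -
  define \<delta> where "\<delta> = ln (r / q)"
  have \<delta>: "0 < \<delta>" using assms by (simp add: \<delta>_def)
  have exp_\<delta>: "exp (- \<delta>) = q / r" using assms by (simp add: \<delta>_def exp_minus)
  have "0 \<le> 2 * B + 2" using assms by simp
  from waiting_time[OF assms(1) this \<delta>] obtain D where D: "0 \<le> D"
    and wait: "\<And>\<nu>. 1 \<le> \<nu> \<Longrightarrow>
      \<exists>d. (2 * B + 2) * growth K (\<nu> + d) \<le> \<delta> * real d \<and> real d \<le> D * growth K \<nu>"
    by blast
  \<comment> \<open>The \<open>2\<close> absorbs the factor \<open>4\<close>.  Over \<open>d \<le> D * growth K \<nu>\<close> steps, \<open>\<delta>\<close> pays for the error at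
    time \<open>\<nu> + d\<close>, \<open>L\<close> for the way back along \<open>h\<close>, and \<open>\<bar>ln r\<bar>\<close> for a possible decay of \<open>f\<close>.\<close>
  define C where "C = 2 + (\<delta> + L + \<bar>ln r\<bar>) * D"
  have C: "2 \<le> C" using D \<delta> assms by (simp add: C_def)
  show ?thesis
  proof (intro exI[of _ C] conjI allI impI)
    show "0 \<le> C" using C by simp
    fix f g h p \<nu>
    assume f: "rate_between K m r r B f" and g: "rate_between K m p q B g"
      and tri: "\<forall>\<mu>\<ge>m. 0 \<le> f \<mu> \<and> 0 \<le> g \<mu> \<and> f \<mu> \<le> g \<mu> + h \<mu> \<and> g \<mu> \<le> f \<mu> + h \<mu> \<and> h (Suc \<mu>) \<le> exp L * h \<mu>"
      and \<nu>: "m \<le> \<nu>"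
    have \<nu>1: "1 \<le> \<nu>" using \<nu> assms by simp
    define G where "G = growth K \<nu>"
    have G: "1 \<le> G" using growth_ge_1[OF \<nu>1] by (simp add: G_def)
    have four: "4 \<le> exp (2 * x)" if "1 \<le> x" for x :: real
    proof -
      have "2 \<le> exp x" using exp_ge_add_one_self[of x] that by linarith
      then have "2 * 2 \<le> exp x * exp x" by (intro mult_mono) auto
      then show ?thesis by (simp add: exp_add[symmetric])
    qed
    have main: "f \<nu> \<le> exp (C * G) * h \<nu> / 2 \<and> g \<nu> \<le> exp (C * G) * h \<nu>"
    proof (cases "2 * f \<nu> \<le> g \<nu>")
      case True
      have h0: "0 \<le> h \<nu>" and "g \<nu> \<le> 2 * h \<nu>" "f \<nu> \<le> h \<nu>" using True tri \<nu> by force+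
      moreover have "4 * h \<nu> \<le> exp (C * G) * h \<nu>"
      proof (rule mult_right_mono)
        have "2 * G \<le> C * G" using C G by (intro mult_right_mono) auto
        then show "4 \<le> exp (C * G)" using four[OF G] by (meson exp_le_cancel_iff order_trans)
      qed fact
      ultimately show ?thesis by auto
    next
      case False
      from wait[OF \<nu>1] obtain d where d1: "(2 * B + 2) * growth K (\<nu> + d) \<le> \<delta> * real d"
        and d2: "real d \<le> D * G" by (auto simp: G_def)
      define G' where "G' = growth K (\<nu> + d)"
      have G': "1 \<le> G'" using growth_ge_1[of "\<nu> + d"] \<nu>1 by (simp add: G'_def)
      have fr: "r ^ d * f \<nu> \<le> exp (B * G') * f (\<nu> + d)"
        using f \<nu> by (simp add: rate_between_def G'_def)
      have gr: "g (\<nu> + d) \<le> exp (B * G') * q ^ d * g \<nu>"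
        using g \<nu> by (simp add: rate_between_def G'_def)
      have rd: "0 < r ^ d" using assms by simp
      have qd: "q ^ d = exp (- \<delta> * real d) * r ^ d"
        unfolding exp_of_nat2_mult exp_\<delta> using assms by (simp add: power_divide)
      have "g (\<nu> + d) \<le> exp (B * G') * q ^ d * (2 * f \<nu>)"
        by (rule order_trans[OF gr]) (use False assms in \<open>auto intro!: mult_left_mono\<close>)
      also have "\<dots> = 2 * exp (B * G') * exp (- \<delta> * real d) * (r ^ d * f \<nu>)" by (simp add: qd)
      also have "\<dots> \<le> 2 * exp (B * G') * exp (- \<delta> * real d) * (exp (B * G') * f (\<nu> + d))"
        by (intro mult_left_mono fr) auto
      also have "\<dots> = 2 * exp (2 * B * G' - \<delta> * real d) * f (\<nu> + d)"
        by (simp add: exp_add[symmetric] exp_diff exp_minus field_simps)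
      also have "\<dots> \<le> 2 * exp (- 2 * G') * f (\<nu> + d)"
        using d1 tri \<nu> by (intro mult_right_mono mult_left_mono) (auto simp: G'_def algebra_simps)
      also have "\<dots> \<le> 1 / 2 * f (\<nu> + d)"
        using four[OF G'] tri \<nu> by (intro mult_right_mono) (auto simp: exp_minus field_simps)
      finally have "f (\<nu> + d) \<le> 2 * h (\<nu> + d)" using tri[rule_format, of "\<nu> + d"] \<nu> by simp
      also have "\<dots> \<le> 2 * (exp (L * real d) * h \<nu>)"
        using iterate_step_bound[of m h L \<nu> d] tri \<nu> by simp
      finally have "r ^ d * f \<nu> \<le> exp (B * G') * (2 * (exp (L * real d) * h \<nu>))"
        by (intro order_trans[OF fr] mult_left_mono) auto
      then have "f \<nu> \<le> exp (B * G') * (2 * (exp (L * real d) * h \<nu>)) / r ^ d"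
        using rd by (simp add: field_simps)
      also have "r ^ d = exp (ln r * real d)" using assms by (simp add: exp_of_nat2_mult)
      finally have fh: "f \<nu> \<le> 2 * exp (B * G' + (L - ln r) * real d) * h \<nu>"
        by (simp add: exp_add exp_diff left_diff_distrib field_simps)
      have h0: "0 \<le> h \<nu>"
      proof -
        have "0 \<le> 2 * exp (B * G' + (L - ln r) * real d) * h \<nu>" using fh tri \<nu> by force
        then show ?thesis by (simp add: zero_le_mult_iff)
      qed
      have "B * G' + (L - ln r) * real d \<le> (\<delta> + L + \<bar>ln r\<bar>) * real d"
      proof -
        have "B * G' \<le> (2 * B + 2) * G'" using assms G' by (intro mult_right_mono) auto
        moreover have "(- ln r) * real d \<le> \<bar>ln r\<bar> * real d" by (intro mult_right_mono) auto
        ultimately show ?thesis using d1 by (simp add: G'_def algebra_simps)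
      qed
      also have "\<dots> \<le> (\<delta> + L + \<bar>ln r\<bar>) * (D * G)"
        using d2 \<delta> assms by (intro mult_left_mono) auto
      finally have "4 * exp (B * G' + (L - ln r) * real d) \<le> exp (2 * G) * exp ((\<delta> + L + \<bar>ln r\<bar>) * (D * G))"
        by (intro mult_mono four G) auto
      also have "\<dots> = exp (C * G)" by (simp add: C_def exp_add[symmetric] algebra_simps)
      finally have "4 * exp (B * G' + (L - ln r) * real d) * h \<nu> \<le> exp (C * G) * h \<nu>"
        by (rule mult_right_mono) (rule h0)
      with fh False show ?thesis by auto
    qed
    have "0 \<le> f \<nu>" using tri \<nu> by blast
    with main show "f \<nu> \<le> exp (C * growth K \<nu>) * h \<nu>" by (simp add: G_def)
    from main show "g \<nu> \<le> exp (C * growth K \<nu>) * h \<nu>" by (simp add: G_def)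
  qed
qed

text \<open>
  Since \<open>no_cancellation\<close> bounds both parts by their sum \<open>h\<close>, the sum inherits the smallest lower and the
  largest upper rate of its parts.
\<close>

lemma rate_between_add:
  assumes "1 \<le> K" "1 \<le> m" "0 \<le> B" "0 \<le> L" "0 < p" "p \<le> q" "q < r"
  shows "\<exists>C\<ge>0. \<forall>f g h. rate_between K m r r B f \<longrightarrow> rate_between K m p q B g \<longrightarrow>
    (\<forall>\<mu>\<ge>m. 0 \<le> f \<mu> \<and> 0 \<le> g \<mu> \<and> f \<mu> \<le> g \<mu> + h \<mu> \<and> g \<mu> \<le> f \<mu> + h \<mu> \<and> h \<mu> \<le> f \<mu> + g \<mu> \<and>
            h (Suc \<mu>) \<le> exp L * h \<mu>) \<longrightarrow> rate_between K m p r C h"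
proof -
  have "0 < q" using assms by simp
  from no_cancellation[OF assms(1-4) this assms(7)] obtain C where C: "0 \<le> C"
    and nc: "\<And>f g h p \<nu>. rate_between K m r r B f \<Longrightarrow> rate_between K m p q B g \<Longrightarrow>
    (\<forall>\<mu>\<ge>m. 0 \<le> f \<mu> \<and> 0 \<le> g \<mu> \<and> f \<mu> \<le> g \<mu> + h \<mu> \<and> g \<mu> \<le> f \<mu> + h \<mu> \<and> h (Suc \<mu>) \<le> exp L * h \<mu>) \<Longrightarrow>
    m \<le> \<nu> \<Longrightarrow> f \<nu> \<le> exp (C * growth K \<nu>) * h \<nu> \<and> g \<nu> \<le> exp (C * growth K \<nu>) * h \<nu>"
    by metis
  show ?thesis
  proof (intro exI[of _ "B + C + 1"] conjI allI impI)
    show "0 \<le> B + C + 1" using assms C by simp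
    fix f g h
    assume f: "rate_between K m r r B f" and g: "rate_between K m p q B g"
      and tri: "\<forall>\<mu>\<ge>m. 0 \<le> f \<mu> \<and> 0 \<le> g \<mu> \<and> f \<mu> \<le> g \<mu> + h \<mu> \<and> g \<mu> \<le> f \<mu> + h \<mu> \<and> h \<mu> \<le> f \<mu> + g \<mu> \<and>
            h (Suc \<mu>) \<le> exp L * h \<mu>"
    have fg: "f \<nu> \<le> exp (C * growth K \<nu>) * h \<nu> \<and> g \<nu> \<le> exp (C * growth K \<nu>) * h \<nu>" if "m \<le> \<nu>" for \<nu>
      using nc[OF f g, of h \<nu>] tri that by blast
    show "rate_between K m p r (B + C + 1) h"
      unfolding rate_between_def
    proof (intro allI impI)
      fix \<nu> d :: nat
      assume \<nu>: "m \<le> \<nu>"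
      define G where "G = growth K (\<nu> + d)"
      have G: "1 \<le> G" using growth_ge_1[of "\<nu> + d" K] \<nu> assms(2) by (simp add: G_def)
      have G_le: "growth K \<nu> \<le> G" using growth_mono[of \<nu> "\<nu> + d" K] \<nu> assms(2) by (simp add: G_def)
      have "2 \<le> exp G" using exp_ge_add_one_self[of G] G by linarith
      then have two: "2 * exp x \<le> exp (x + G)" for x by (simp add: exp_add)
      have h0: "0 \<le> h \<mu>" if "m \<le> \<mu>" for \<mu>
      proof -
        have "0 \<le> exp (C * growth K \<mu>) * h \<mu>" using fg[OF that] tri that by (meson order_trans)
        then show ?thesis by (simp add: zero_le_mult_iff)
      qed
      have pr: "p ^ d \<le> r ^ d" and qr: "q ^ d \<le> r ^ d" using assms by (auto intro: power_mono)
      have r0: "0 \<le> r ^ d" and p0: "0 \<le> p ^ d" using assms by auto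
      have "p ^ d * h \<nu> \<le> p ^ d * f \<nu> + p ^ d * g \<nu>"
        using tri \<nu> p0 by (metis distrib_left mult_left_mono)
      also have "\<dots> \<le> r ^ d * f \<nu> + p ^ d * g \<nu>"
        using pr tri \<nu> by (intro add_mono mult_right_mono) auto
      also have "\<dots> \<le> exp (B * G) * f (\<nu> + d) + exp (B * G) * g (\<nu> + d)"
        using f g \<nu> by (intro add_mono) (auto simp: rate_between_def G_def)
      also have "\<dots> \<le> exp (B * G) * (exp (C * G) * h (\<nu> + d)) + exp (B * G) * (exp (C * G) * h (\<nu> + d))"
        using fg[of "\<nu> + d"] \<nu> by (intro add_mono mult_left_mono) (auto simp: G_def)
      also have "\<dots> = 2 * exp (B * G + C * G) * h (\<nu> + d)" by (simp add: exp_add)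
      also have "\<dots> \<le> exp ((B * G + C * G) + G) * h (\<nu> + d)"
        using h0[of "\<nu> + d"] \<nu> by (intro mult_right_mono two) auto
      finally have 1: "p ^ d * h \<nu> \<le> exp ((B + C + 1) * G) * h (\<nu> + d)" by (simp add: algebra_simps)
      have "h (\<nu> + d) \<le> f (\<nu> + d) + g (\<nu> + d)" using tri \<nu> by simp
      also have "\<dots> \<le> exp (B * G) * r ^ d * f \<nu> + exp (B * G) * q ^ d * g \<nu>"
        using f g \<nu> by (intro add_mono) (auto simp: rate_between_def G_def)
      also have "\<dots> \<le> exp (B * G) * r ^ d * f \<nu> + exp (B * G) * r ^ d * g \<nu>"
        using qr tri \<nu> by (intro add_mono mult_right_mono mult_left_mono) auto
      also have "\<dots> \<le> exp (B * G) * r ^ d * (exp (C * growth K \<nu>) * h \<nu>) + exp (B * G) * r ^ d * (exp (C * growth K \<nu>) * h \<nu>)"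
        using fg[of "\<nu>"] \<nu> r0 by (intro add_mono mult_left_mono) auto
      also have "\<dots> = 2 * exp (B * G + C * growth K \<nu>) * (r ^ d * h \<nu>)" by (simp add: exp_add)
      also have "\<dots> \<le> exp (B * G + C * growth K \<nu> + G) * (r ^ d * h \<nu>)"
        using h0[of "\<nu>"] \<nu> r0 by (intro mult_right_mono two) auto
      also have "\<dots> \<le> exp ((B + C + 1) * G) * (r ^ d * h \<nu>)"
        using h0[of "\<nu>"] \<nu> r0 G_le C mult_left_mono[OF G_le C]
        by (intro mult_right_mono) (auto simp: algebra_simps)
      finally have 2: "h (\<nu> + d) \<le> exp ((B + C + 1) * G) * r ^ d * h \<nu>" by simp
      show "p ^ d * h \<nu> \<le> exp ((B + C + 1) * growth K (\<nu> + d)) * h (\<nu> + d) \<and>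
         h (\<nu> + d) \<le> exp ((B + C + 1) * growth K (\<nu> + d)) * r ^ d * h \<nu>"
        using 1 2 by (simp add: G_def)
    qed
  qed
qed

lemma rate_between_mono:
  assumes "rate_between K m p q B f" "B \<le> B'" "0 \<le> q" "\<And>\<nu>. m \<le> \<nu> \<Longrightarrow> 0 \<le> f \<nu>" "1 \<le> m"
  shows "rate_between K m p q B' f"
  unfolding rate_between_def
proof (intro allI impI)
  fix \<nu> d :: nat
  assume \<nu>: "m \<le> \<nu>"
  define G where "G = growth K (\<nu> + d)"
  have "1 \<le> G" using growth_ge_1[of "\<nu> + d" K] \<nu> assms(5) by (simp add: G_def)
  then have le: "exp (B * G) \<le> exp (B' * G)" using assms(2) by simp
  have "exp (B * G) * f (\<nu> + d) \<le> exp (B' * G) * f (\<nu> + d)"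
    using le assms(4)[of "\<nu> + d"] \<nu> by (intro mult_right_mono) auto
  moreover have "exp (B * G) * q ^ d * f \<nu> \<le> exp (B' * G) * q ^ d * f \<nu>"
    using le assms(3) assms(4)[of \<nu>] \<nu> by (intro mult_right_mono) auto
  ultimately show "p ^ d * f \<nu> \<le> exp (B' * growth K (\<nu> + d)) * f (\<nu> + d) \<and>
         f (\<nu> + d) \<le> exp (B' * growth K (\<nu> + d)) * q ^ d * f \<nu>"
    using assms(1) \<nu> unfolding rate_between_def G_def by (meson order_trans)
qed

text \<open>
  The hypothesis \<open>(N - \<alpha> \<nu> * f m) * \<dots> \<le> f \<nu>\<close> says nothing until \<open>\<alpha>\<close> has become small.  Instead of
  treating the finitely many early times separately, the lower bound at time \<open>\<nu>\<close> is always obtained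
  from the one at time \<open>\<nu> + \<nu>\<^sub>0\<close> by the one-step bound.
\<close>

lemma rate_between_from_initial:
  fixes \<alpha> :: "nat \<Rightarrow> real"
  assumes "1 \<le> m" "0 < r" "0 \<le> A" "0 < C" "\<alpha> \<longlonglongrightarrow> 0"
  shows "\<exists>B\<ge>0. \<forall>f N. (\<forall>\<nu>\<ge>m. 0 \<le> f \<nu> \<and> f (Suc \<nu>) \<le> exp L * f \<nu> \<and>
      f \<nu> \<le> exp (A * growth K \<nu>) * r ^ \<nu> * f m \<and>
      (N - \<alpha> \<nu> * f m) * r ^ \<nu> * exp (- A * growth K \<nu>) \<le> f \<nu>) \<longrightarrow> f m \<le> C * N \<longrightarrow>
      rate_between K m r r B f"
proof -
  have "eventually (\<lambda>\<nu>. \<alpha> \<nu> < 1 / (2 * C)) sequentially"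
    using assms by (intro order_tendstoD(2)) auto
  from eventually_conj[OF this eventually_ge_at_top[of 1]]
  obtain \<nu>\<^sub>0 where \<nu>0: "\<And>\<nu>. \<nu>\<^sub>0 \<le> \<nu> \<Longrightarrow> \<alpha> \<nu> < 1 / (2 * C) \<and> 1 \<le> \<nu>"
    by (auto simp: eventually_sequentially)
  \<comment> \<open>\<open>\<kappa>\<close> collects everything that the shift by \<open>\<nu>\<^sub>0\<close> costs and that does not depend on \<open>\<nu>\<close>.\<close>
  define \<kappa> where "\<kappa> = r ^ \<nu>\<^sub>0 * exp (- 3 * A * growth K \<nu>\<^sub>0) / (2 * C) / exp (L * real \<nu>\<^sub>0)"
  have \<kappa>: "0 < \<kappa>" using assms by (simp add: \<kappa>_def)
  define E where "E = \<bar>ln \<kappa>\<bar>"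
  show ?thesis
  proof (intro exI[of _ "4 * A + E"] conjI allI impI)
    show "0 \<le> 4 * A + E" using assms by (simp add: E_def)
    fix f N
    assume f: "\<forall>\<nu>\<ge>m. 0 \<le> f \<nu> \<and> f (Suc \<nu>) \<le> exp L * f \<nu> \<and>
      f \<nu> \<le> exp (A * growth K \<nu>) * r ^ \<nu> * f m \<and>
      (N - \<alpha> \<nu> * f m) * r ^ \<nu> * exp (- A * growth K \<nu>) \<le> f \<nu>"
      and N: "f m \<le> C * N"
    have low: "r ^ \<nu> * f m \<le> exp ((3 * A + E) * growth K \<nu>) * f \<nu>" if \<nu>: "m \<le> \<nu>" for \<nu>
    proof -
      define G where "G = growth K \<nu>"
      have \<nu>1: "1 \<le> \<nu>" using \<nu> assms by simp
      have G: "1 \<le> G" using growth_ge_1[OF \<nu>1] by (simp add: G_def)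
      have fm: "0 \<le> f m" using f by simp
      have "\<alpha> (\<nu> + \<nu>\<^sub>0) * f m \<le> 1 / (2 * C) * f m"
        using \<nu>0[of "\<nu> + \<nu>\<^sub>0"] fm by (intro mult_right_mono) auto
      moreover have "f m / C \<le> N" using N assms by (simp add: field_simps)
      ultimately have N': "f m / (2 * C) \<le> N - \<alpha> (\<nu> + \<nu>\<^sub>0) * f m"
        using assms by (simp add: field_simps)
      have "growth K (\<nu> + \<nu>\<^sub>0) \<le> 3 * (G + growth K \<nu>\<^sub>0)"
        using growth_add_le[OF \<nu>1, of \<nu>\<^sub>0 K] \<nu>0[of \<nu>\<^sub>0] by (simp add: G_def)
      from mult_left_mono[OF this assms(3)]
      have Gs: "- 3 * A * G + - 3 * A * growth K \<nu>\<^sub>0 \<le> - A * growth K (\<nu> + \<nu>\<^sub>0)"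
        by (simp add: algebra_simps)
      have "\<kappa> * exp (L * real \<nu>\<^sub>0) * (r ^ \<nu> * exp (- 3 * A * G) * f m)
          = f m / (2 * C) * r ^ (\<nu> + \<nu>\<^sub>0) * exp (- 3 * A * G + - 3 * A * growth K \<nu>\<^sub>0)"
        by (simp only: \<kappa>_def exp_add power_add) simp
      also have "\<dots> \<le> f m / (2 * C) * r ^ (\<nu> + \<nu>\<^sub>0) * exp (- A * growth K (\<nu> + \<nu>\<^sub>0))"
        using fm assms Gs by (intro mult_left_mono) auto
      also have "\<dots> \<le> (N - \<alpha> (\<nu> + \<nu>\<^sub>0) * f m) * r ^ (\<nu> + \<nu>\<^sub>0) * exp (- A * growth K (\<nu> + \<nu>\<^sub>0))"
        using assms by (intro mult_right_mono N') auto
      also have "\<dots> \<le> f (\<nu> + \<nu>\<^sub>0)" using f \<nu> by simp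
      also have "\<dots> \<le> exp (L * real \<nu>\<^sub>0) * f \<nu>"
        by (rule iterate_step_bound[of m]) (use f \<nu> in auto)
      finally have "\<kappa> * (r ^ \<nu> * exp (- 3 * A * G) * f m) \<le> f \<nu>"
        by (simp add: mult.assoc mult.left_commute[of \<kappa>])
      moreover have "exp (- E * G) \<le> \<kappa>"
      proof -
        have "E * 1 \<le> E * G" using G by (intro mult_left_mono) (auto simp: E_def)
        then have "- E * G \<le> ln \<kappa>" by (simp add: E_def)
        then have "exp (- E * G) \<le> exp (ln \<kappa>)" by (simp only: exp_le_cancel_iff)
        then show ?thesis using \<kappa> by simp
      qed
      ultimately have "exp (- E * G) * (r ^ \<nu> * exp (- 3 * A * G) * f m) \<le> f \<nu>"
        using fm assms(2) by (meson mult_right_mono order_trans mult_nonneg_nonneg exp_ge_zero zero_le_power less_imp_le)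
      then have "exp ((3 * A + E) * G) * (exp (- E * G) * (r ^ \<nu> * exp (- 3 * A * G) * f m))
          \<le> exp ((3 * A + E) * G) * f \<nu>"
        by (rule mult_left_mono) simp
      also have "exp ((3 * A + E) * G) * (exp (- E * G) * (r ^ \<nu> * exp (- 3 * A * G) * f m))
          = exp ((3 * A + E) * G + - E * G + - 3 * A * G) * (r ^ \<nu> * f m)"
        by (simp only: exp_add ac_simps)
      also have "\<dots> = r ^ \<nu> * f m" by (simp add: algebra_simps)
      finally show ?thesis by (simp add: G_def)
    qed
    show "rate_between K m r r (4 * A + E) f"
      unfolding rate_between_def
    proof (intro allI impI conjI)
      fix \<nu> d :: nat
      assume \<nu>: "m \<le> \<nu>"
      define G where "G = growth K \<nu>"
      define G' where "G' = growth K (\<nu> + d)"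
      have GG: "G \<le> G'" using growth_mono[of \<nu> "\<nu> + d" K] \<nu> assms by (simp add: G_def G'_def)
      have rd: "0 \<le> r ^ d" using assms by simp
      have A3: "0 \<le> 3 * A + E" using assms by (simp add: E_def)
      have "r ^ d * f \<nu> \<le> r ^ d * (exp (A * G) * r ^ \<nu> * f m)"
        using f \<nu> by (intro mult_left_mono rd) (auto simp: G_def)
      also have "\<dots> = exp (A * G) * (r ^ (\<nu> + d) * f m)" by (simp add: power_add)
      also have "\<dots> \<le> exp (A * G) * (exp ((3 * A + E) * G') * f (\<nu> + d))"
        using low[of "\<nu> + d"] \<nu> by (intro mult_left_mono) (auto simp: G'_def)
      also have "\<dots> = exp (A * G + (3 * A + E) * G') * f (\<nu> + d)" by (simp add: exp_add)
      also have "\<dots> \<le> exp ((4 * A + E) * G') * f (\<nu> + d)"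
        using f \<nu> mult_left_mono[OF GG assms(3)] by (intro mult_right_mono) (auto simp: algebra_simps)
      finally show "r ^ d * f \<nu> \<le> exp ((4 * A + E) * growth K (\<nu> + d)) * f (\<nu> + d)"
        by (simp add: G'_def)
      have "f (\<nu> + d) \<le> exp (A * G') * r ^ (\<nu> + d) * f m" using f \<nu> by (simp add: G'_def)
      also have "\<dots> = exp (A * G') * r ^ d * (r ^ \<nu> * f m)" by (simp add: power_add)
      also have "\<dots> \<le> exp (A * G') * r ^ d * (exp ((3 * A + E) * G) * f \<nu>)"
        using low[OF \<nu>] rd by (intro mult_left_mono) (auto simp: G_def)
      also have "\<dots> = exp (A * G' + (3 * A + E) * G) * (r ^ d * f \<nu>)" by (simp add: exp_add)
      also have "\<dots> \<le> exp ((4 * A + E) * G') * (r ^ d * f \<nu>)"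
        using f \<nu> mult_left_mono[OF GG A3] rd by (intro mult_right_mono) (auto simp: algebra_simps)
      finally show "f (\<nu> + d) \<le> exp ((4 * A + E) * growth K (\<nu> + d)) * r ^ d * f \<nu>"
        by (simp add: G'_def)
    qed
  qed
qed

section \<open>The size of solutions and the boundedness of linear maps\<close>

lemma cmod_le_omega:
  assumes "\<nu> \<le> i" "i < \<nu> + n"
  shows "cmod (y i) \<le> omega n y \<nu>"
  unfolding omega_def using assms by (intro Max_ge) auto

lemma omega_le:
  assumes "1 \<le> n" "\<And>i. \<nu> \<le> i \<Longrightarrow> i < \<nu> + n \<Longrightarrow> cmod (y i) \<le> c"
  shows "omega n y \<nu> \<le> c"
  unfolding omega_def using assms by (intro Max.boundedI) auto

lemma omega_nonneg:
  assumes "1 \<le> n"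
  shows "0 \<le> omega n y \<nu>"
  using cmod_le_omega[of \<nu> \<nu> n y] assms by (meson norm_ge_zero order_trans order_refl less_add_same_cancel1 less_le_trans zero_less_one)

lemma omega_add_le:
  assumes "1 \<le> n"
  shows "omega n (x + y) \<nu> \<le> omega n x \<nu> + omega n y \<nu>"
  by (rule omega_le[OF assms])
    (auto intro: order_trans[OF norm_triangle_ineq add_mono[OF cmod_le_omega cmod_le_omega]])

lemma omega_minus: "omega n (- y) \<nu> = omega n y \<nu>"
  by (simp add: omega_def)

lemma omega_cscale_le:
  assumes "1 \<le> n"
  shows "omega n (cscale c y) \<nu> \<le> cmod c * omega n y \<nu>"
  by (rule omega_le[OF assms]) (auto simp: cscale_def norm_mult intro: mult_left_mono cmod_le_omega)

lemma omega_sum_le: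
  assumes "1 \<le> n"
  shows "omega n (\<Sum>i\<in>I. w i) \<nu> \<le> (\<Sum>i\<in>I. omega n (w i) \<nu>)"
proof (induction I rule: infinite_finite_induct)
  case (insert i I)
  then show ?case
    unfolding sum.insert[OF insert.hyps]
    by (intro order_trans[OF omega_add_le[OF assms]] add_left_mono)
qed (auto intro!: omega_le assms)

text \<open>
  Shifting the window by one brings in a single new value, which the recurrence expresses through
  the old window with bounded coefficients.
\<close>

lemma omega_step_bound:
  assumes "1 \<le> n" "\<And>\<nu>. a n \<nu> = 1"
    and "\<And>i. i \<le> n \<Longrightarrow> Bseq (a i)"
  shows "\<exists>L\<ge>0. \<forall>y\<in>sol_space n a m. \<forall>\<nu>\<ge>m. omega n y (Suc \<nu>) \<le> exp L * omega n y \<nu>"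
proof -
  have "\<forall>i\<in>{0..<n}. \<exists>M. 0 < M \<and> (\<forall>\<nu>. cmod (a i \<nu>) \<le> M)"
    using assms(3) by (auto simp: Bseq_def)
  then obtain M where M: "\<And>i \<nu>. i < n \<Longrightarrow> 0 < M i \<and> cmod (a i \<nu>) \<le> M i"
    by (metis atLeastLessThan_iff le0)
  define L where "L = (\<Sum>i=0..<n. M i)"
  have L: "0 \<le> L" unfolding L_def using M by (intro sum_nonneg) (simp add: less_imp_le)
  have L1: "1 \<le> exp L" "L \<le> exp L" using L exp_ge_add_one_self[of L] by linarith+
  show ?thesis
  proof (intro exI[of _ L] conjI L ballI allI impI)
    fix y \<nu>
    assume y: "y \<in> sol_space n a m" and \<nu>: "m \<le> \<nu>"
    have w0: "0 \<le> omega n y \<nu>" by (rule omega_nonneg) fact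
    have "{0..n} = insert n {0..<n}" by auto
    then have "(\<Sum>k=0..<n. a k \<nu> * y (\<nu> + k)) + y (\<nu> + n) = 0"
      using y \<nu> assms(2) by (auto simp: sol_space_def add.commute)
    then have "cmod (y (\<nu> + n)) = cmod (\<Sum>k=0..<n. a k \<nu> * y (\<nu> + k))"
      by (metis add_eq_0_iff norm_minus_cancel)
    also have "\<dots> \<le> (\<Sum>k=0..<n. M k * omega n y \<nu>)"
    proof (rule sum_norm_le)
      fix k assume "k \<in> {0..<n}"
      then show "cmod (a k \<nu> * y (\<nu> + k)) \<le> M k * omega n y \<nu>"
        unfolding norm_mult using M[of k] by (intro mult_mono cmod_le_omega) (auto simp: less_imp_le)
    qed
    also have "\<dots> = L * omega n y \<nu>" by (simp add: L_def sum_distrib_right)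
    also have "\<dots> \<le> exp L * omega n y \<nu>" by (intro mult_right_mono L1 w0)
    finally have new: "cmod (y (\<nu> + n)) \<le> exp L * omega n y \<nu>" .
    show "omega n y (Suc \<nu>) \<le> exp L * omega n y \<nu>"
    proof (rule omega_le[OF assms(1)])
      fix i assume i: "Suc \<nu> \<le> i" "i < Suc \<nu> + n"
      show "cmod (y i) \<le> exp L * omega n y \<nu>"
      proof (cases "i = \<nu> + n")
        case False
        then have "cmod (y i) \<le> 1 * omega n y \<nu>" using i by (simp add: cmod_le_omega)
        also have "\<dots> \<le> exp L * omega n y \<nu>" by (intro mult_right_mono L1 w0)
        finally show ?thesis .
      qed (use new in simp)
    qed
  qed
qed

lemma subspace_sol_space: "cseq.subspace (sol_space n a m)"
proof (rule cseq.subspaceI)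
  fix c x assume "x \<in> sol_space n a m"
  moreover have "(\<Sum>k=0..n. a k \<nu> * (c * x (\<nu> + k))) = c * (\<Sum>k=0..n. a k \<nu> * x (\<nu> + k))" for \<nu>
    by (simp add: sum_distrib_left algebra_simps)
  ultimately show "cscale c x \<in> sol_space n a m"
    by (auto simp: sol_space_def cscale_def)
qed (auto simp: sol_space_def ring_distribs sum.distrib)

lemma solution_eq_0:
  assumes "1 \<le> n" "\<And>\<nu>. m \<le> \<nu> \<Longrightarrow> omega n y (Suc \<nu>) \<le> exp L * omega n y \<nu>"
    and "y \<in> sol_space n a m" "\<And>i. m \<le> i \<Longrightarrow> i < m + n \<Longrightarrow> y i = 0"
  shows "y = 0"
proof
  fix \<nu>
  show "y \<nu> = 0 \<nu>"
  proof (cases "\<nu> < m")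
    case False
    then obtain d where d: "\<nu> = m + d" by (metis le_Suc_ex not_le)
    have "omega n y m \<le> 0" using assms by (intro omega_le) auto
    have "cmod (y \<nu>) \<le> omega n y (m + d)" using assms(1) by (intro cmod_le_omega) (auto simp: d)
    also have "\<dots> \<le> exp (L * real d) * omega n y m" by (intro iterate_step_bound assms) auto
    also have "\<dots> \<le> 0" using \<open>omega n y m \<le> 0\<close> by (simp add: mult_le_0_iff)
    finally show ?thesis by simp
  qed (use assms(3) in \<open>auto simp: sol_space_def\<close>)
qed

text \<open>
  If finitely many coordinates separate the points of \<open>W\<close>, every linear map on \<open>W\<close> is a linear
  expression in these coordinates.  The induction is Gaussian elimination: on the kernel of one
  coordinate the others still separate points, and one vector \<open>z\<close> with \<open>z i = 1\<close> complements
  that kernel.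
\<close>

lemma linear_map_via_coordinates:
  assumes "finite F" "cseq.subspace W" "\<And>y. y \<in> W \<Longrightarrow> (\<forall>i\<in>F. y i = 0) \<Longrightarrow> y = 0"
    and "\<And>x y. x \<in> W \<Longrightarrow> y \<in> W \<Longrightarrow> f (x + y) = f x + f y"
    and "\<And>c y. y \<in> W \<Longrightarrow> f (cscale c y) = cscale c (f y)"
  shows "\<exists>x. \<forall>y\<in>W. f y = (\<Sum>i\<in>F. cscale (y i) (x i))"
  using assms
proof (induction F arbitrary: W rule: finite_induct)
  case empty
  have "f 0 = 0"
    using empty(4)[of 0 0] cseq.subspace_0[OF empty(1)] cseq.scale_zero_left
    by (metis empty.prems(4))
  then have "f y = 0" if "y \<in> W" for y using empty.prems(2)[OF that] by (metis empty_iff)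
  then show ?case by (simp only: sum.empty) blast
next
  case (insert i F)
  define W' where "W' = {y \<in> W. y i = 0}"
  have "cseq.subspace W'"
    using insert.prems(1) unfolding cseq.subspace_def W'_def by (auto simp: cscale_def)
  then obtain x where x: "\<And>y. y \<in> W' \<Longrightarrow> f y = (\<Sum>j\<in>F. cscale (y j) (x j))"
    using insert.IH[of W'] insert.prems by (auto simp: W'_def)
  show ?case
  proof (cases "W' = W")
    case True
    have "f y = (\<Sum>j\<in>insert i F. cscale (y j) (x j))" if "y \<in> W" for y
    proof -
      have "y i = 0" "y \<in> W'" using that True by (auto simp: W'_def)
      then show ?thesis using x[of y] insert.hyps by simp
    qed
    then show ?thesis by blast
  next
    case False
    then obtain v where v: "v \<in> W" "v i \<noteq> 0" by (auto simp: W'_def)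
    define z where "z = cscale (1 / v i) v"
    have z: "z \<in> W" unfolding z_def by (rule cseq.subspace_scale[OF insert.prems(1) v(1)])
    have zi: "z i = 1" using v by (simp add: z_def cscale_def)
    define x' where "x' = (\<lambda>j. if j = i then f z - (\<Sum>j\<in>F. cscale (z j) (x j)) else x j)"
    have "f y = (\<Sum>j\<in>insert i F. cscale (y j) (x' j))" if y: "y \<in> W" for y
    proof -
      define y' where "y' = y + cscale (- y i) z"
      have "y' \<in> W" unfolding y'_def
        using y z cseq.subspace_add[OF insert.prems(1)] cseq.subspace_scale[OF insert.prems(1)] by blast
      moreover have "y' i = 0" using zi by (simp add: y'_def cscale_def)
      ultimately have y': "y' \<in> W'" by (simp add: W'_def)
      have zz: "cscale (y i) z \<in> W" using z insert.prems(1) by (simp add: cseq.subspace_def)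
      have eq: "y = y' + cscale (y i) z" by (auto simp: y'_def cscale_def)
      have "f y = f y' + f (cscale (y i) z)"
        using insert.prems(3)[of y' "cscale (y i) z"] y' zz eq by (auto simp: W'_def)
      also have "\<dots> = (\<Sum>j\<in>F. cscale (y' j) (x j)) + cscale (y i) (f z)"
        using x[OF y'] insert.prems(4) z by simp
      also have "(\<Sum>j\<in>F. cscale (y' j) (x j)) =
          (\<Sum>j\<in>F. cscale (y j) (x j)) - cscale (y i) (\<Sum>j\<in>F. cscale (z j) (x j))"
        unfolding cseq.scale_sum_right sum_subtractf[symmetric]
        by (intro sum.cong) (auto simp: y'_def cscale_def fun_eq_iff algebra_simps)
      also have "(\<Sum>j\<in>F. cscale (y j) (x j)) = (\<Sum>j\<in>F. cscale (y j) (x' j))"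
        using insert.hyps by (intro sum.cong) (auto simp: x'_def)
      finally have fy: "f y = (\<Sum>j\<in>F. cscale (y j) (x' j)) -
          cscale (y i) (\<Sum>j\<in>F. cscale (z j) (x j)) + cscale (y i) (f z)" .
      have "x' i = f z - (\<Sum>j\<in>F. cscale (z j) (x j))" by (simp only: x'_def if_True refl)
      then show ?thesis
        unfolding sum.insert[OF insert.hyps] fy
        by (subst add.commute) (simp only: cseq.scale_right_diff_distrib add_diff_eq diff_add_eq)
    qed
    then show ?thesis by blast
  qed
qed

text \<open>
  The \<open>n\<close> initial values separate solutions, so they can serve as the coordinates above; the values
  occurring in \<open>omega n y m\<close> are exactly these.
\<close>

lemma linear_map_omega_bounded:
  assumes "1 \<le> n" "\<And>y \<nu>. y \<in> sol_space n a m \<Longrightarrow> m \<le> \<nu> \<Longrightarrow> omega n y (Suc \<nu>) \<le> exp L * omega n y \<nu>"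
    and "cseq.subspace W" "W \<subseteq> sol_space n a m" "linear_map_between W X f"
  shows "\<exists>C\<ge>0. \<forall>y\<in>W. omega n (f y) m \<le> C * omega n y m"
proof -
  have "\<exists>x. \<forall>y\<in>W. f y = (\<Sum>i\<in>{m..<m+n}. cscale (y i) (x i))"
  proof (rule linear_map_via_coordinates)
    fix y assume "y \<in> W" "\<forall>i\<in>{m..<m+n}. y i = 0"
    moreover from this have sol: "y \<in> sol_space n a m" using assms(4) by blast
    ultimately show "y = 0" using assms(2)[OF sol] by (intro solution_eq_0[OF assms(1) _ sol]) auto
  next
    show "cseq.subspace W" by fact
    show "f (x + y) = f x + f y" if "x \<in> W" "y \<in> W" for x y
      using assms(5) that unfolding linear_map_between_def by blast
    show "f (cscale c y) = cscale c (f y)" if "y \<in> W" for c y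
      using assms(5) that unfolding linear_map_between_def by blast
  qed simp
  then obtain x where x: "\<And>y. y \<in> W \<Longrightarrow> f y = (\<Sum>i\<in>{m..<m+n}. cscale (y i) (x i))" by blast
  show ?thesis
  proof (intro exI[of _ "\<Sum>i\<in>{m..<m+n}. omega n (x i) m"] conjI ballI)
    show "0 \<le> (\<Sum>i\<in>{m..<m+n}. omega n (x i) m)" by (intro sum_nonneg omega_nonneg assms)
    fix y assume y: "y \<in> W"
    have "omega n (f y) m \<le> (\<Sum>i\<in>{m..<m+n}. omega n (cscale (y i) (x i)) m)"
      using omega_sum_le[OF assms(1)] by (simp add: x[OF y])
    also have "\<dots> \<le> (\<Sum>i\<in>{m..<m+n}. omega n y m * omega n (x i) m)"
      by (intro sum_mono order_trans[OF omega_cscale_le[OF assms(1)]] mult_right_mono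
            cmod_le_omega omega_nonneg assms) auto
    finally show "omega n (f y) m \<le> (\<Sum>i\<in>{m..<m+n}. omega n (x i) m) * omega n y m"
      by (simp add: sum_distrib_left mult.commute)
  qed
qed

section \<open>Direct sums of sequence spaces\<close>

lemma subspace_subspace_sum:
  assumes "\<And>i. i \<in> I \<Longrightarrow> cseq.subspace (W i)"
  shows "cseq.subspace (subspace_sum I W)"
proof (rule cseq.subspaceI)
  show "0 \<in> subspace_sum I W"
    unfolding subspace_sum_def using assms
    by (auto intro!: exI[of _ "\<lambda>_. 0"] simp: cseq.subspace_0)
next
  fix x y assume "x \<in> subspace_sum I W" "y \<in> subspace_sum I W"
  then obtain v w where vw: "x = (\<Sum>i\<in>I. v i)" "\<forall>i\<in>I. v i \<in> W i" "y = (\<Sum>i\<in>I. w i)" "\<forall>i\<in>I. w i \<in> W i"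
    by (auto simp: subspace_sum_def)
  have "x + y = (\<Sum>i\<in>I. v i + w i)" by (simp only: vw sum.distrib)
  moreover have "\<forall>i\<in>I. v i + w i \<in> W i" using vw assms cseq.subspace_add by blast
  ultimately show "x + y \<in> subspace_sum I W"
    unfolding subspace_sum_def by blast
next
  fix c x assume "x \<in> subspace_sum I W"
  then obtain v where v: "x = (\<Sum>i\<in>I. v i)" "\<forall>i\<in>I. v i \<in> W i"
    by (auto simp: subspace_sum_def)
  have "cscale c x = (\<Sum>i\<in>I. cscale c (v i))" by (simp only: v cseq.scale_sum_right)
  moreover have "\<forall>i\<in>I. cscale c (v i) \<in> W i" using v assms cseq.subspace_scale by blast
  ultimately show "cscale c x \<in> subspace_sum I W"
    unfolding subspace_sum_def by blast
qed

lemma subspace_sum_mono: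
  assumes "finite J" "I \<subseteq> J" "\<And>i. i \<in> J \<Longrightarrow> cseq.subspace (W i)"
  shows "subspace_sum I W \<subseteq> subspace_sum J W"
proof
  fix x assume "x \<in> subspace_sum I W"
  then obtain w where w: "x = (\<Sum>i\<in>I. w i)" "\<forall>i\<in>I. w i \<in> W i" by (auto simp: subspace_sum_def)
  define w' where "w' = (\<lambda>i. if i \<in> I then w i else 0)"
  have "x = (\<Sum>i\<in>J. w' i)" unfolding w
    using assms by (intro sum.mono_neutral_cong_left) (auto simp: w'_def)
  moreover have "\<forall>i\<in>J. w' i \<in> W i" using w assms by (auto simp: w'_def cseq.subspace_0)
  ultimately show "x \<in> subspace_sum J W" unfolding subspace_sum_def by blast
qed

lemma summand_subset_subspace_sum:
  assumes "finite J" "j \<in> J" "\<And>i. i \<in> J \<Longrightarrow> cseq.subspace (W i)"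
  shows "W j \<subseteq> subspace_sum J W"
proof -
  have "W j \<subseteq> subspace_sum {j} W" unfolding subspace_sum_def by auto
  with subspace_sum_mono[of J "{j}" W] assms show ?thesis by auto
qed

lemma linear_map_between_sum:
  assumes "linear_map_between U X f" "cseq.subspace U" "\<And>i. i \<in> I \<Longrightarrow> w i \<in> U"
  shows "f (\<Sum>i\<in>I. w i) = (\<Sum>i\<in>I. f (w i))"
proof -
  have add: "\<And>x y. x \<in> U \<Longrightarrow> y \<in> U \<Longrightarrow> f (x + y) = f x + f y"
    using assms(1) unfolding linear_map_between_def by blast
  have "f (0 + 0) = f 0 + f 0" by (intro add cseq.subspace_0 assms)
  then have zero: "f 0 = 0" by (metis add_cancel_left_right add_0)
  show ?thesis using assms(3)
  proof (induction I rule: infinite_finite_induct)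
    case (infinite I)
    then show ?case by (metis sum.infinite zero)
  next
    case empty
    show ?case by (simp only: sum.empty zero)
  next
    case (insert i I)
    then show ?case unfolding sum.insert[OF insert.hyps]
      by (subst add) (auto intro: cseq.subspace_sum assms(2))
  qed
qed

lemma vproj_eqI:
  assumes "is_direct_sum {1..s+1} W U" "j \<in> {1..s}" "v \<in> W j" "y - v \<in> Vwedge s W (j + 1)"
  shows "vproj s W j y = v"
  unfolding vproj_def
proof (rule the_equality)
  fix v' assume v': "v' \<in> W j \<and> y - v' \<in> Vwedge s W (j + 1)"
  have sub: "\<And>i. i \<in> {1..s+1} \<Longrightarrow> cseq.subspace (W i)"
    using assms(1) by (simp add: is_direct_sum_def)
  have "cseq.subspace (Vwedge s W (j + 1))"
    unfolding Vwedge_def by (rule subspace_subspace_sum) (use sub in auto)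
  then have "(y - v) - (y - v') \<in> Vwedge s W (j + 1)"
    using assms(4) v' cseq.subspace_diff by blast
  moreover have "(y - v) - (y - v') = v' - v" by (rule diff_diff_eq2[THEN trans]) (simp only: algebra_simps)
  ultimately have "v' - v \<in> Vwedge s W (j + 1)" by metis
  then obtain w where w: "v' - v = (\<Sum>i\<in>{j+1..s+1}. w i)" "\<forall>i\<in>{j+1..s+1}. w i \<in> W i"
    by (auto simp: Vwedge_def subspace_sum_def)
  define w' where "w' = (\<lambda>i. if i = j then v - v' else if j < i then w i else 0)"
  have "(\<Sum>i\<in>{1..s+1}. w' i) = (\<Sum>i\<in>insert j {j+1..s+1}. w' i)"
    using assms(2) by (intro sum.mono_neutral_right) (auto simp: w'_def)
  also have "\<dots> = w' j + (\<Sum>i\<in>{j+1..s+1}. w' i)" by (intro sum.insert) auto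
  also have "(\<Sum>i\<in>{j+1..s+1}. w' i) = (\<Sum>i\<in>{j+1..s+1}. w i)"
    by (intro sum.cong) (auto simp: w'_def)
  also have "w' j + \<dots> = 0" unfolding w(1)[symmetric] by (simp add: w'_def)
  finally have "(\<Sum>i\<in>{1..s+1}. w' i) = 0" .
  moreover have j: "j \<in> {1..s+1}" using assms(2) by simp
  moreover have "\<forall>i\<in>{1..s+1}. w' i \<in> W i"
    using w(2) assms(3) v' sub j
    by (auto simp: w'_def cseq.subspace_diff cseq.subspace_0)
  ultimately have "w' j = 0"
    using assms(1) j unfolding is_direct_sum_def by blast
  then have "v - v' = 0" by (simp only: w'_def if_True refl)
  then show "v' = v" by (metis eq_iff_diff_eq_0)
qed (use assms in auto)

section \<open>The lower bound\<close>

text \<open>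
  Adding the components from the slowest one, \<open>u t\<close>, upwards keeps the partial sum strictly slower
  than the next component, as \<open>rate_between_add\<close> requires.
\<close>

lemma rate_between_sum:
  assumes "1 \<le> n" "1 \<le> K" "1 \<le> m" "0 \<le> B" "0 \<le> L" "cseq.subspace S"
    and step: "\<And>y \<nu>. y \<in> S \<Longrightarrow> m \<le> \<nu> \<Longrightarrow> omega n y (Suc \<nu>) \<le> exp L * omega n y \<nu>"
    and pos: "0 < r t" and decr: "\<And>i. j \<le> i \<Longrightarrow> i < t \<Longrightarrow> r (Suc i) < r i"
    and "j \<le> t"
  shows "\<exists>C\<ge>0. \<forall>u. (\<forall>i\<in>{j..t}. u i \<in> S \<and> rate_between K m (r i) (r i) B (omega n (u i))) \<longrightarrow>
      rate_between K m (r t) (r j) C (omega n (\<Sum>i\<in>{j..t}. u i))"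
    (is "?P j")
proof -
  have "?P j \<and> r t \<le> r j"
    using \<open>j \<le> t\<close> decr
  proof (induction j rule: inc_induct)
    case base
    show ?case using assms by (intro conjI exI[of _ B]) auto
  next
    case (step j)
    have rj: "r (Suc j) < r j" using step.prems step.hyps by simp
    have IH: "?P (Suc j) \<and> r t \<le> r (Suc j)" using step.IH step.prems by (metis Suc_leD)
    then have rtj: "r t \<le> r (Suc j)" by blast
    obtain C where C: "0 \<le> C"
      and rest: "\<And>u. (\<forall>i\<in>{Suc j..t}. u i \<in> S \<and> rate_between K m (r i) (r i) B (omega n (u i))) \<Longrightarrow>
        rate_between K m (r t) (r (Suc j)) C (omega n (\<Sum>i\<in>{Suc j..t}. u i))"
      using IH by blast
    define B' where "B' = max B C"
    have "0 \<le> B'" using C by (simp add: B'_def)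
    from rate_between_add[OF assms(2,3) this assms(5) pos rtj rj]
    obtain D where D: "0 \<le> D" and add: "\<And>f g h. rate_between K m (r j) (r j) B' f \<Longrightarrow>
        rate_between K m (r t) (r (Suc j)) B' g \<Longrightarrow>
        (\<forall>\<mu>\<ge>m. 0 \<le> f \<mu> \<and> 0 \<le> g \<mu> \<and> f \<mu> \<le> g \<mu> + h \<mu> \<and> g \<mu> \<le> f \<mu> + h \<mu> \<and> h \<mu> \<le> f \<mu> + g \<mu> \<and>
            h (Suc \<mu>) \<le> exp L * h \<mu>) \<Longrightarrow> rate_between K m (r t) (r j) D h"
      by blast
    show ?case
    proof (intro exI[of _ D] conjI D allI impI)
      show "r t \<le> r j" using rtj rj by simp
      fix u assume u: "\<forall>i\<in>{j..t}. u i \<in> S \<and> rate_between K m (r i) (r i) B (omega n (u i))"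
      define z where "z = (\<Sum>i\<in>{Suc j..t}. u i)"
      have sum: "(\<Sum>i\<in>{j..t}. u i) = u j + z"
        unfolding z_def using step.hyps by (intro sum.atLeast_Suc_atMost) simp
      have f: "rate_between K m (r j) (r j) B' (omega n (u j))"
        using u step.hyps rtj rj pos assms(3)
        by (intro rate_between_mono[of K m _ _ B _ B']) (auto simp: B'_def omega_nonneg[OF assms(1)])
      have g: "rate_between K m (r t) (r (Suc j)) B' (omega n z)"
        using rest[of u] u step.hyps rtj rj pos assms(3) unfolding z_def
        by (intro rate_between_mono[of K m _ _ C _ B']) (auto simp: B'_def omega_nonneg[OF assms(1)])
      have S: "u j + z \<in> S"
        unfolding z_def using u step.hyps
        by (intro cseq.subspace_add cseq.subspace_sum assms(6)) auto
      have "omega n (u j) \<mu> \<le> omega n z \<mu> + omega n (u j + z) \<mu>" for \<mu>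
        using omega_add_le[OF assms(1), of "- z" "z + u j" \<mu>]
        unfolding minus_add_cancel omega_minus by (simp only: add.commute[of z "u j"])
      moreover have "omega n z \<mu> \<le> omega n (u j) \<mu> + omega n (u j + z) \<mu>" for \<mu>
        using omega_add_le[OF assms(1), of "- u j" "u j + z" \<mu>]
        by (simp only: minus_add_cancel omega_minus)
      ultimately show "rate_between K m (r t) (r j) D (omega n (\<Sum>i\<in>{j..t}. u i))"
        unfolding sum using assms(7)[OF S] omega_nonneg[OF assms(1)] omega_add_le[OF assms(1)]
        by (intro add[OF f g] allI impI conjI) assumption+
    qed
  qed
  then show ?thesis ..
qed

text \<open>
  Positivity matters because \<open>growth k \<nu>\<close> increases with \<open>k\<close> only from \<open>k = 1\<close> on: as division by \<open>0\<close>
  gives \<open>0\<close>, \<open>growth 0 \<nu>\<close> is \<open>ln \<nu> + \<nu>\<close>.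
\<close>

lemma mult_max_pos:
  assumes "mult_sum T r > 0"
  shows "1 \<le> mult_max T r"
proof -
  have fin: "finite (roots_of_modulus T r)"
    using assms by (metis mult_sum_def sum.infinite less_irrefl)
  obtain z where z: "z \<in> roots_of_modulus T r" "order z T \<noteq> 0"
    using assms unfolding mult_sum_def by (metis less_irrefl sum.neutral)
  have "order z T \<le> mult_max T r"
    unfolding mult_max_def using fin z by (intro Max_ge) auto
  with z show ?thesis by simp
qed

lemma Bseq_if_bigo_deviation:
  assumes "(\<lambda>\<nu>. f \<nu> - c) \<in> O(\<lambda>\<nu>. 1 / of_nat (\<nu> + 1) :: complex)"
  shows "Bseq f"
proof -
  have "(\<lambda>\<nu>. 1 / of_nat (\<nu> + 1) :: complex) \<in> O(\<lambda>_. 1)"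
    by (intro bigoI[of _ 1] always_eventually allI) (simp add: norm_divide del: of_nat_Suc of_nat_add)
  with assms have "(\<lambda>\<nu>. f \<nu> - c) \<in> O(\<lambda>_. 1)" by (rule landau_o.big_trans)
  then have "(\<lambda>\<nu>. (f \<nu> - c) + c) \<in> O(\<lambda>_. 1)" by (rule sum_in_bigo) simp
  then show ?thesis
    by (auto elim!: landau_o.bigE intro: BfunI)
qed

theorem theorem9:
  fixes s n m \<theta> :: nat
    and a_lim :: "nat \<Rightarrow> complex" and a :: "nat \<Rightarrow> nat \<Rightarrow> complex"
    and \<rho> :: "nat \<Rightarrow> real" and A :: real and \<alpha> :: "nat \<Rightarrow> real"
    and T :: "complex poly" and e k :: "nat \<Rightarrow> nat"
    and Vvee :: "nat \<Rightarrow> (nat \<Rightarrow> complex) set"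
    and \<xi> :: "(nat \<Rightarrow> complex) \<Rightarrow> (nat \<Rightarrow> complex)"
    and V :: "(nat \<Rightarrow> complex) set"
  assumes n_pos: "n \<ge> 1"
    and a_lead: "\<And>\<nu>. a n \<nu> = 1"
    and a_asymp: "\<And>i. i \<le> n \<Longrightarrow> (\<lambda>\<nu>. a i \<nu> - a_lim i) \<in> O(\<lambda>\<nu>. 1 / of_nat (\<nu> + 1))"
    and T_eq: "T = characteristic_poly n a_lim"
    and \<rho>_decr: "\<And>i. i \<in> {1..s} \<Longrightarrow> \<rho> (i + 1) < \<rho> i"
    and \<rho>_last: "\<rho> (s + 1) = 0"
    and roots: "\<And>z. poly T z = 0 \<Longrightarrow> cmod z \<in> \<rho> ` {1..s+1}"
    and e_eq: "\<And>i. i \<in> {1..s+1} \<Longrightarrow> e i = mult_sum T (\<rho> i)"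
    and k_eq: "\<And>i. i \<in> {1..s+1} \<Longrightarrow> k i = mult_max T (\<rho> i)"
    and e_pos: "\<And>i. i \<in> {1..s} \<Longrightarrow> e i > 0"
    and A_pos: "A > 0"
    and m_pos: "m \<ge> 1"
    and \<alpha>_pos: "\<And>\<nu>. \<nu> \<ge> m \<Longrightarrow> \<alpha> \<nu> > 0"
    and \<alpha>_lim: "\<alpha> \<longlonglongrightarrow> 0"
    and decomp: "is_direct_sum {1..s+1} Vvee (sol_space n a m)"
    and dims: "\<And>i. i \<in> {1..s+1} \<Longrightarrow> cseq.dim (Vvee i) = e i"
    and lower_vee: "\<And>j y \<nu>. j \<in> {1..s} \<Longrightarrow> y \<in> Vvee j \<Longrightarrow> \<nu> \<ge> m \<Longrightarrow>
          exp (- A * growth (k j) \<nu>) * \<rho> j ^ \<nu> * omega n y m \<le> omega n y \<nu>"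
    and upper_wedge: "\<And>j y \<nu>. j \<in> {1..s} \<Longrightarrow> y \<in> Vwedge s Vvee j \<Longrightarrow> \<nu> \<ge> m \<Longrightarrow>
          omega n y \<nu> \<le> exp (A * growth (k j) \<nu>) * \<rho> j ^ \<nu> * omega n y m"
    and lower_wedge: "\<And>j y \<nu>. j \<in> {1..s} \<Longrightarrow> y \<in> Vwedge s Vvee j \<Longrightarrow> \<nu> \<ge> m \<Longrightarrow>
          (omega n (vproj s Vvee j y) m - \<alpha> \<nu> * omega n y m) * \<rho> j ^ \<nu> *
            exp (- A * growth (k j) \<nu>) \<le> omega n y \<nu>"
    and upper_last: "\<And>y \<nu>. k (s + 1) > 0 \<Longrightarrow> y \<in> Vvee (s + 1) \<Longrightarrow> \<nu> \<ge> m \<Longrightarrow>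
          cmod (y \<nu>) \<le> (A / real \<nu>) powr (real \<nu> / real (k (s + 1))) * omega n y m"
    and \<theta>_range: "\<theta> \<in> {1..s}"
    and \<xi>_linear: "linear_map_between (Vstar Vvee \<theta>) (Vwedge s Vvee (\<theta> + 1)) \<xi>"
    and V_eq: "V = (\<lambda>y. y + \<xi> y) ` Vstar Vvee \<theta>"
  shows "\<exists>Astar>0. \<forall>y\<in>V. \<forall>\<nu>\<ge>m.
           exp (- Astar * growth (Max (k ` {1..s})) \<nu>) * \<rho> \<theta> ^ \<nu> * omega n y m
             \<le> omega n y \<nu>"
proof -
  have \<theta>: "1 \<le> \<theta>" "\<theta> \<le> s" using \<theta>_range by auto
  define K where "K = Max (k ` {1..s})"
  have k_pos: "1 \<le> k i" if "i \<in> {1..s}" for i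
    using that e_eq[of i] k_eq[of i] e_pos[of i] mult_max_pos[of T "\<rho> i"] by auto
  have k_le: "k i \<le> K" if "i \<in> {1..s}" for i
    unfolding K_def using that by (intro Max_ge) auto
  have K: "1 \<le> K" using k_pos[OF \<theta>_range] k_le[OF \<theta>_range] by linarith
  have growth_le: "growth (k i) \<nu> \<le> growth K \<nu>" if "i \<in> {1..s}" "m \<le> \<nu>" for i \<nu>
    using that k_pos k_le m_pos by (intro growth_mono_multiplicity) auto

  have \<rho>_pos: "0 < \<rho> i" if "i \<in> {1..s}" for i
  proof -
    from that have "i \<le> s" by simp
    then show ?thesis using that
    proof (induction i rule: inc_induct)
      case base
      then show ?case using \<rho>_decr[of s] \<rho>_last by simp
    next
      case (step i)
      then show ?case using \<rho>_decr[of i] by force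
    qed
  qed

  have "Bseq (a i)" if "i \<le> n" for i
    using a_asymp[OF that] by (rule Bseq_if_bigo_deviation)
  from omega_step_bound[of n a m, OF n_pos a_lead this] obtain L where L: "0 \<le> L"
    and step: "\<And>y \<nu>. y \<in> sol_space n a m \<Longrightarrow> m \<le> \<nu> \<Longrightarrow> omega n y (Suc \<nu>) \<le> exp L * omega n y \<nu>"
    by blast

  have sub: "cseq.subspace (Vvee i)" if "i \<in> {1..s+1}" for i
    using decomp[unfolded is_direct_sum_def, THEN conjunct1] that by blast
  have sol: "sol_space n a m = subspace_sum {1..s+1} Vvee"
    by (rule decomp[unfolded is_direct_sum_def, THEN conjunct2, THEN conjunct1])
  have sub_star: "cseq.subspace (Vstar Vvee \<theta>)"
    unfolding Vstar_def by (rule subspace_subspace_sum, rule sub) (use \<theta> in auto)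
  have star_sol: "Vstar Vvee \<theta> \<subseteq> sol_space n a m"
    unfolding Vstar_def sol by (rule subspace_sum_mono[OF _ _ sub]) (use \<theta> in auto)
  have vee_star: "Vvee i \<subseteq> Vstar Vvee \<theta>" if "i \<in> {1..\<theta>}" for i
    unfolding Vstar_def by (rule summand_subset_subspace_sum[OF _ _ sub]) (use \<theta> that in auto)
  have sub_wedge: "cseq.subspace (Vwedge s Vvee i)" if "1 \<le> i" for i
    unfolding Vwedge_def by (rule subspace_subspace_sum, rule sub) (use that in auto)
  have wedge_mono: "Vwedge s Vvee j \<subseteq> Vwedge s Vvee i" if "1 \<le> i" "i \<le> j" for i j
    unfolding Vwedge_def by (rule subspace_sum_mono[OF _ _ sub]) (use that in auto)
  have wedge_sol: "Vwedge s Vvee i \<subseteq> sol_space n a m" if "1 \<le> i" for i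
    unfolding Vwedge_def sol by (rule subspace_sum_mono[OF _ _ sub]) (use that in auto)
  have vee_wedge: "Vvee i \<subseteq> Vwedge s Vvee i" if "i \<in> {1..s+1}" for i
    unfolding Vwedge_def by (rule summand_subset_subspace_sum[OF _ _ sub]) (use that in auto)

  from linear_map_omega_bounded[OF n_pos step sub_star star_sol \<xi>_linear]
  obtain C\<^sub>0 where C0: "0 \<le> C\<^sub>0"
    and \<xi>_bound: "\<And>y. y \<in> Vstar Vvee \<theta> \<Longrightarrow> omega n (\<xi> y) m \<le> C\<^sub>0 * omega n y m"
    by auto
  define C where "C = 1 + C\<^sub>0"
  have C: "0 < C" using C0 by (simp add: C_def)

  have summand: "\<exists>B\<ge>0. \<forall>w\<in>Vvee i. rate_between K m (\<rho> i) (\<rho> i) B (omega n (w + \<xi> w))"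
    if i: "i \<in> {1..\<theta>}" for i
  proof -
    have i_le_s: "i \<in> {1..s}" using i \<theta> by auto
    have A0: "0 \<le> A" using A_pos by simp
    obtain B where B: "0 \<le> B" and rate: "\<And>f N. (\<forall>\<nu>\<ge>m. 0 \<le> f \<nu> \<and> f (Suc \<nu>) \<le> exp L * f \<nu> \<and>
      f \<nu> \<le> exp (A * growth K \<nu>) * \<rho> i ^ \<nu> * f m \<and>
      (N - \<alpha> \<nu> * f m) * \<rho> i ^ \<nu> * exp (- A * growth K \<nu>) \<le> f \<nu>) \<Longrightarrow> f m \<le> C * N \<Longrightarrow>
      rate_between K m (\<rho> i) (\<rho> i) B f"
      using rate_between_from_initial[OF m_pos \<rho>_pos[OF i_le_s] A0 C \<alpha>_lim, where K = K and L = L]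
      by blast
    show ?thesis
    proof (intro exI[of _ B] conjI B ballI)
      fix w assume w: "w \<in> Vvee i"
      define u where "u = w + \<xi> w"
      have w_star: "w \<in> Vstar Vvee \<theta>" using w vee_star[OF i] by blast
      have \<xi>w: "\<xi> w \<in> Vwedge s Vvee (\<theta> + 1)"
        using \<xi>_linear w_star unfolding linear_map_between_def by blast
      have \<xi>w': "\<xi> w \<in> Vwedge s Vvee (i + 1)" "\<xi> w \<in> Vwedge s Vvee i"
        using wedge_mono[of "i + 1" "\<theta> + 1"] wedge_mono[of i "\<theta> + 1"] \<xi>w i by auto
      have u_wedge: "u \<in> Vwedge s Vvee i"
        unfolding u_def using sub_wedge[of i] vee_wedge[of i] w \<xi>w' i_le_s
        by (intro cseq.subspace_add) auto
      have "u - w = \<xi> w" by (simp only: u_def add_diff_cancel_left')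
      then have proj: "vproj s Vvee i u = w"
        using \<xi>w'(1) by (intro vproj_eqI[OF decomp i_le_s w]) metis
      have u_sol: "u \<in> sol_space n a m" using u_wedge wedge_sol[of i] i_le_s by auto
      have N: "omega n u m \<le> C * omega n w m"
        using omega_add_le[OF n_pos, of w "\<xi> w" m] \<xi>_bound[OF w_star]
        by (simp only: u_def C_def distrib_right mult_1_left)
      show "rate_between K m (\<rho> i) (\<rho> i) B (omega n (w + \<xi> w))"
        unfolding u_def[symmetric]
      proof (rule rate[where f = "omega n u" and N = "omega n w m", OF _ N], intro allI impI conjI)
        fix \<nu> assume \<nu>: "m \<le> \<nu>"
        show u0: "0 \<le> omega n u \<nu>" by (rule omega_nonneg[OF n_pos])
        show "omega n u (Suc \<nu>) \<le> exp L * omega n u \<nu>" by (rule step[OF u_sol \<nu>])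
        have g: "A * growth (k i) \<nu> \<le> A * growth K \<nu>"
          using growth_le[OF i_le_s \<nu>] A0 by (rule mult_left_mono)
        have r: "0 \<le> \<rho> i ^ \<nu>" using \<rho>_pos[OF i_le_s] by simp
        have "omega n u \<nu> \<le> exp (A * growth (k i) \<nu>) * \<rho> i ^ \<nu> * omega n u m"
          by (rule upper_wedge[OF i_le_s u_wedge \<nu>])
        also have "\<dots> \<le> exp (A * growth K \<nu>) * \<rho> i ^ \<nu> * omega n u m"
          using g r omega_nonneg[OF n_pos] by (intro mult_right_mono) auto
        finally show "omega n u \<nu> \<le> exp (A * growth K \<nu>) * \<rho> i ^ \<nu> * omega n u m" .
        define X where "X = omega n w m - \<alpha> \<nu> * omega n u m"
        have low: "X * \<rho> i ^ \<nu> * exp (- A * growth (k i) \<nu>) \<le> omega n u \<nu>"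
          using lower_wedge[OF i_le_s u_wedge \<nu>] by (simp add: proj X_def)
        show "X * \<rho> i ^ \<nu> * exp (- A * growth K \<nu>) \<le> omega n u \<nu>"
        \<comment> \<open>Enlarging the growth function from \<open>k i\<close> to \<open>K\<close> weakens the bound only if \<open>X\<close> is nonnegative.\<close>
        proof (cases "0 \<le> X")
          case True
          then have "X * \<rho> i ^ \<nu> * exp (- A * growth K \<nu>) \<le> X * \<rho> i ^ \<nu> * exp (- A * growth (k i) \<nu>)"
            using g r by (intro mult_left_mono) auto
          with low show ?thesis by simp
        next
          case False
          then have "X * \<rho> i ^ \<nu> * exp (- A * growth K \<nu>) \<le> 0"
            using r by (simp add: mult_nonpos_nonneg)
          with u0 show ?thesis by simp
        qed
      qed
    qed
  qed
  then obtain B where B: "\<And>i w. i \<in> {1..\<theta>} \<Longrightarrow> 0 \<le> B i \<and>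
      (w \<in> Vvee i \<longrightarrow> rate_between K m (\<rho> i) (\<rho> i) (B i) (omega n (w + \<xi> w)))"
    by metis
  define B\<^sub>1 where "B\<^sub>1 = (\<Sum>i\<in>{1..\<theta>}. B i)"
  have B_le: "B i \<le> B\<^sub>1" if "i \<in> {1..\<theta>}" for i
    unfolding B\<^sub>1_def using that B by (intro member_le_sum) auto
  have B1: "0 \<le> B\<^sub>1" unfolding B\<^sub>1_def using B by (intro sum_nonneg) auto

  have \<theta>_pos: "0 < \<rho> \<theta>" using \<rho>_pos \<theta>_range by blast
  obtain D where D: "0 \<le> D" and sum_rate: "\<And>u. (\<forall>i\<in>{1..\<theta>}. u i \<in> sol_space n a m \<and>
        rate_between K m (\<rho> i) (\<rho> i) B\<^sub>1 (omega n (u i))) \<Longrightarrow>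
      rate_between K m (\<rho> \<theta>) (\<rho> 1) D (omega n (\<Sum>i\<in>{1..\<theta>}. u i))"
    using rate_between_sum[where r = \<rho> and j = 1 and t = \<theta> and S = "sol_space n a m" and K = K
        and m = m and n = n and B = B\<^sub>1 and L = L, OF n_pos K m_pos B1 L subspace_sol_space step \<theta>_pos]
      \<rho>_decr \<theta> by auto

  \<comment> \<open>The rate bound starts at time \<open>m\<close> and yields \<open>\<rho> \<theta> ^ (\<nu> - m)\<close>; \<open>c\<close> supplies \<open>\<rho> \<theta> ^ m\<close>.\<close>
  define c where "c = \<bar>ln (\<rho> \<theta> ^ m)\<bar>"
  define A' where "A' = D + c + 1"
  have c: "0 \<le> c" by (simp add: c_def)
  show ?thesis
  proof (intro exI[of _ A'] conjI ballI allI impI)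
    show "0 < A'" using D c by (simp add: A'_def)
    fix y \<nu> assume y: "y \<in> V" and \<nu>: "m \<le> \<nu>"
    then obtain v where v: "v \<in> Vstar Vvee \<theta>" "y = v + \<xi> v" unfolding V_eq by blast
    obtain w where w: "v = (\<Sum>i\<in>{1..\<theta>}. w i)" "\<And>i. i \<in> {1..\<theta>} \<Longrightarrow> w i \<in> Vvee i"
      using v(1) unfolding Vstar_def subspace_sum_def by blast
    have w_star: "\<And>i. i \<in> {1..\<theta>} \<Longrightarrow> w i \<in> Vstar Vvee \<theta>" using w(2) vee_star by blast
    have \<xi>v: "\<xi> v = (\<Sum>i\<in>{1..\<theta>}. \<xi> (w i))"
      unfolding w(1) by (rule linear_map_between_sum[OF \<xi>_linear sub_star w_star])
    have y_sum: "y = (\<Sum>i\<in>{1..\<theta>}. w i + \<xi> (w i))"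
      unfolding v(2) \<xi>v sum.distrib unfolding w(1) ..
    have "rate_between K m (\<rho> \<theta>) (\<rho> 1) D (omega n y)"
      unfolding y_sum
    proof (rule sum_rate, intro ballI conjI)
      fix i assume i: "i \<in> {1..\<theta>}"
      have "\<xi> (w i) \<in> Vwedge s Vvee (\<theta> + 1)"
        using \<xi>_linear w_star[OF i] unfolding linear_map_between_def by blast
      then show "w i + \<xi> (w i) \<in> sol_space n a m"
        using w_star[OF i] star_sol wedge_sol[of "\<theta> + 1"]
        by (intro cseq.subspace_add subspace_sol_space) auto
      have "0 \<le> \<rho> i" using \<rho>_pos[of i] i \<theta> by auto
      then show "rate_between K m (\<rho> i) (\<rho> i) B\<^sub>1 (omega n (w i + \<xi> (w i)))"
        using B[OF i, of "w i"] w(2)[OF i] B_le[OF i] omega_nonneg[OF n_pos] m_pos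
        by (intro rate_between_mono[of K m _ _ "B i" _ B\<^sub>1]) auto
    qed
    from this[unfolded rate_between_def, rule_format, of m "\<nu> - m"]
    have lower: "\<rho> \<theta> ^ (\<nu> - m) * omega n y m \<le> exp (D * growth K \<nu>) * omega n y \<nu>"
      using \<nu> by simp
    have G: "1 \<le> growth K \<nu>" using growth_ge_1[of \<nu> K] \<nu> m_pos by simp
    have y0: "0 \<le> omega n y \<nu>" by (rule omega_nonneg[OF n_pos])
    have "\<rho> \<theta> ^ m = exp (ln (\<rho> \<theta> ^ m))" using \<theta>_pos by simp
    also have "\<dots> \<le> exp (c * growth K \<nu>)"
      using mult_left_mono[OF G c] by (simp add: c_def)
    finally have c': "\<rho> \<theta> ^ m \<le> exp (c * growth K \<nu>)" .
    have "\<rho> \<theta> ^ \<nu> * omega n y m = \<rho> \<theta> ^ m * (\<rho> \<theta> ^ (\<nu> - m) * omega n y m)"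
      using \<nu> by (simp add: power_add[symmetric])
    also have "\<dots> \<le> exp (c * growth K \<nu>) * (exp (D * growth K \<nu>) * omega n y \<nu>)"
      using \<theta>_pos omega_nonneg[OF n_pos, of y m] by (intro mult_mono[OF c' lower]) auto
    also have "\<dots> = exp ((c + D) * growth K \<nu>) * omega n y \<nu>" by (simp add: exp_add algebra_simps)
    also have "\<dots> \<le> exp (A' * growth K \<nu>) * omega n y \<nu>"
      using G y0 by (intro mult_right_mono) (auto simp: A'_def)
    finally have "exp (- A' * growth K \<nu>) * (\<rho> \<theta> ^ \<nu> * omega n y m) \<le>
        exp (- A' * growth K \<nu>) * (exp (A' * growth K \<nu>) * omega n y \<nu>)"
      by (rule mult_left_mono) simp
    also have "\<dots> = omega n y \<nu>" by (simp add: exp_minus)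
    finally show "exp (- A' * growth (Max (k ` {1..s})) \<nu>) * \<rho> \<theta> ^ \<nu> * omega n y m \<le> omega n y \<nu>"
      by (simp add: K_def mult.assoc)
  qed
qed

end
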